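(* For every positive integer $k$ there exists a polynomial $p_k$ in one variable, depending only on $k$, such that the following holds. Let $m,n\ge 1$ be integers, let $A\in\mathbb{Z}^{m\times n}$ be a $k$-modular matrix of full row rank, i.e. $\operatorname{rank}(A)=m$, and let $\boldsymbol b\in\mathbb{Z}^m$, $\boldsymbol c\in\mathbb{Z}^n$. Assume that the integer optimization problem $$\max\left\{\boldsymbol c^T\boldsymbol x : A\boldsymbol x=\boldsymbol b,\ \boldsymbol x\ge\boldsymbol 0,\ \boldsymbol x\in\mathbb{Z}^n\right\}$$ is feasible and that its maximum is attained. Then the problem has an optimal solution $\boldsymbol z^*$ with $|\operatorname{supp}(\boldsymbol z^* )|\le p_k(m)$.
   Context: Given a positive integer $k$, an integer matrix $A$ is called $k$-modular if the absolute values of all its subdeterminants (determinants of square submatrices of every size, including $1\times 1$) are bounded by $k$. For $\boldsymbol x\in\mathbb{R}^n$, $\operatorname{supp}(\boldsymbol x):=\{i\in\{1,\ldots,n\}: x_i\ne 0\}$. *)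

theory Defs
  imports
    "Jordan_Normal_Form.DL_Submatrix"
    "Jordan_Normal_Form.DL_Rank"
    "HOL-Computational_Algebra.Polynomial"
begin

(* The index sets may be empty; the empty minor equals 1, so it imposes no
   constraint as long as k is positive. *)
definition k_modular :: "nat \<Rightarrow> int mat \<Rightarrow> bool" where
  "k_modular k A \<longleftrightarrow>
     (\<forall>I J. I \<subseteq> {..<dim_row A} \<and> J \<subseteq> {..<dim_col A} \<and> card I = card J \<longrightarrow>
        \<bar>det (submatrix A I J)\<bar> \<le> int k)"

(* The rank of an integer matrix is taken over the field of rationals. The
   argument of vec_space.rank is the dimension of the column space's ambient
   space, i.e. the number of rows. *)
definition int_rank :: "int mat \<Rightarrow> nat" where
  "int_rank A = vec_space.rank (dim_row A) (map_mat rat_of_int A)"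

definition supp :: "'a :: zero vec \<Rightarrow> nat set" where
  "supp x = {i. i < dim_vec x \<and> x $ i \<noteq> 0}"

definition ip_feasible :: "int mat \<Rightarrow> int vec \<Rightarrow> int vec \<Rightarrow> bool" where
  "ip_feasible A b x \<longleftrightarrow> x \<in> carrier_vec (dim_col A) \<and> A *\<^sub>v x = b \<and> 0\<^sub>v (dim_col A) \<le> x"

definition ip_optimal :: "int mat \<Rightarrow> int vec \<Rightarrow> int vec \<Rightarrow> int vec \<Rightarrow> bool" where
  "ip_optimal A b c z \<longleftrightarrow>
     ip_feasible A b z \<and> (\<forall>x. ip_feasible A b x \<longrightarrow> c \<bullet> x \<le> c \<bullet> z)"

end

theory Submission
  imports Defs
begin

text \<open>
  Shifting weight between two equal columns towards the one with the larger cost keeps a solution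
  optimal, so an optimal solution of minimal support uses pairwise distinct columns. It remains to
  bound the number of distinct columns of a k-modular matrix. Its entries lie in
  Q = {-k, ..., k}, and Natarajan's multi-valued version of the Sauer-Shelah lemma says that a set
  of more than polynomially many vectors over Q shatters a large set of rows, i.e. there are two
  distinct values in each of these rows such that every choice of one of the two in every row is
  realised by a column. By the pigeonhole principle the pair of values {a, b}
  with a nonzero can be taken constant on d = 2k + 2 rows, and there the matrix with b
  on the diagonal and a elsewhere is a submatrix up to the order of columns. Its determinant is a nonzero multiple of
  the row sum b + (d - 1) a, whose absolute value exceeds k.
\<close>

section \<open>Natarajan shattering and the Sauer-Shelah type bound\<close>

text \<open>For a two-element codomain this is the usual VC shattering; here the two competing
  values may vary with the coordinate. The empty set is shattered exactly by the nonempty families,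
  which is what settles the case \<open>s = 0\<close> below.\<close>

definition shatters :: "('a \<Rightarrow> 'b) set \<Rightarrow> 'a set \<Rightarrow> ('a \<Rightarrow> 'b) \<Rightarrow> ('a \<Rightarrow> 'b) \<Rightarrow> bool" where
  "shatters F I u v \<longleftrightarrow>
     (\<forall>i\<in>I. u i \<noteq> v i) \<and> (\<forall>S\<subseteq>I. \<exists>f\<in>F. \<forall>i\<in>I. f i = (if i \<in> S then v i else u i))"

lemma shattersE:
  assumes "shatters F I u v" "S \<subseteq> I"
  obtains f where "f \<in> F" "\<And>i. i \<in> I \<Longrightarrow> f i = (if i \<in> S then v i else u i)"
proof -
  have "\<exists>f\<in>F. \<forall>i\<in>I. f i = (if i \<in> S then v i else u i)"
    using assms by (simp add: shatters_def)
  then show ?thesis using that by auto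
qed

text \<open>
  Removing the coordinate \<open>x\<close>, every function beyond one chosen extension of each restriction is
  charged to a pair of values at \<open>x\<close> that both occur over the same restriction.
\<close>
lemma card_le_if_not_shatters:
  assumes "finite R" "finite Q" "F \<subseteq> R \<rightarrow>\<^sub>E Q"
    and "\<And>I u v. I \<subseteq> R \<Longrightarrow> u \<in> I \<rightarrow> Q \<Longrightarrow> v \<in> I \<rightarrow> Q \<Longrightarrow> shatters F I u v \<Longrightarrow> card I < s"
  shows "card F \<le> (1 + card Q ^ 2 * card R) ^ s"
  using assms(1,3,4)
proof (induction R arbitrary: F s rule: finite_induct)
  case empty
  then have "F \<subseteq> {\<lambda>_. undefined}" by auto
  from card_mono[OF _ this] show ?case by simp
next
  case (insert x R)
  show ?case
  proof (cases s)
    case 0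
    have "F = {}"
    proof (rule ccontr)
      assume "F \<noteq> {}"
      then have "shatters F {} u u" for u by (auto simp: shatters_def)
      from insert.prems(2)[of "{}", OF _ _ _ this] 0 show False by auto
    qed
    then show ?thesis by simp
  next
    case (Suc t)
    define G where "G = (\<lambda>f. f(x := undefined)) ` F"
    define H where "H = (\<lambda>(p, q). {g \<in> G. g(x := p) \<in> F \<and> g(x := q) \<in> F})"
    define P where "P = {(p, q) \<in> Q \<times> Q. p \<noteq> q}"
    define w where "w g = (SOME p. p \<in> Q \<and> g(x := p) \<in> F)" for g
    define C where "C = card Q ^ 2"
    define r where "r = 1 + C * card R"
    have G: "G \<subseteq> R \<rightarrow>\<^sub>E Q"
    proof
      fix g assume "g \<in> G"
      then obtain f where f: "f \<in> F" "g = f(x := undefined)" by (auto simp: G_def)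
      have "f \<in> insert x R \<rightarrow>\<^sub>E Q" using f insert.prems(1) by auto
      then show "g \<in> R \<rightarrow>\<^sub>E Q" using f(2) insert.hyps(2) by (auto simp: PiE_iff extensional_def)
    qed
    have "finite (R \<rightarrow>\<^sub>E Q)" using insert.hyps assms(2) by (simp add: finite_PiE)
    then have finG: "finite G" using G finite_subset by blast
    have finP: "finite P" using assms(2) by (auto simp: P_def intro: finite_subset[of _ "Q \<times> Q"])
    have cardP: "card P \<le> C"
      using card_mono[of "Q \<times> Q" P] assms(2)
      by (auto simp: P_def C_def card_cartesian_product power2_eq_square)
    have "card G \<le> r ^ s"
      unfolding r_def C_def
    proof (rule insert.IH[OF G])
      fix I u v assume I: "I \<subseteq> R" "u \<in> I \<rightarrow> Q" "v \<in> I \<rightarrow> Q" "shatters G I u v"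
      have "x \<notin> I" using I(1) insert.hyps by auto
      have "\<exists>f\<in>F. \<forall>i\<in>I. f i = (if i \<in> S then v i else u i)" if S: "S \<subseteq> I" for S
      proof -
        obtain g where g: "g \<in> G" "\<And>i. i \<in> I \<Longrightarrow> g i = (if i \<in> S then v i else u i)"
          using shattersE[OF I(4) S] by blast
        then obtain f where f: "f \<in> F" "g = f(x := undefined)" by (auto simp: G_def)
        then have "f i = g i" if "i \<in> I" for i using that \<open>x \<notin> I\<close> by auto
        then show ?thesis using f(1) g(2) by (intro bexI[of _ f]) auto
      qed
      then have "shatters F I u v" using I(4) by (auto simp: shatters_def)
      then show "card I < s" using insert.prems(2) I by blast
    qed
    \<comment> \<open>If \<open>H (p, q)\<close> shatters \<open>I\<close>, then \<open>F\<close>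
      shatters \<open>insert x I\<close> with \<open>p\<close> and \<open>q\<close> as the two
      values at \<open>x\<close>. Hence the sets shattered by \<open>H (p, q)\<close> have fewer
      than \<open>t\<close> elements, one less than allowed for \<open>F\<close>.\<close>
    moreover have "card (H pq) \<le> r ^ t" if pq: "pq \<in> P" for pq
      unfolding r_def C_def
    proof (rule insert.IH)
      obtain p q where pq': "pq = (p, q)" "p \<in> Q" "q \<in> Q" "p \<noteq> q"
        using pq by (auto simp: P_def)
      show "H pq \<subseteq> R \<rightarrow>\<^sub>E Q" using G by (auto simp: H_def pq')
      fix I u v assume I: "I \<subseteq> R" "u \<in> I \<rightarrow> Q" "v \<in> I \<rightarrow> Q" "shatters (H pq) I u v"
      have xI: "x \<notin> I" and finI: "finite I"
        using I(1) insert.hyps by (auto intro: finite_subset)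
      have "\<exists>f\<in>F. \<forall>i\<in>insert x I. f i = (if i \<in> S then (v(x := q)) i else (u(x := p)) i)"
        if "S \<subseteq> insert x I" for S
      proof -
        have sub: "S - {x} \<subseteq> I" using that by auto
        obtain g where g: "g \<in> H pq"
          "\<And>i. i \<in> I \<Longrightarrow> g i = (if i \<in> S - {x} then v i else u i)"
          using shattersE[OF I(4) sub] by blast
        show ?thesis
        proof (cases "x \<in> S")
          case True
          have "g(x := q) \<in> F" using g by (auto simp: H_def pq')
          then show ?thesis using True g(2) xI by (intro bexI[of _ "g(x := q)"]) auto
        next
          case False
          have "g(x := p) \<in> F" using g by (auto simp: H_def pq')
          then show ?thesis using False g(2) xI by (intro bexI[of _ "g(x := p)"]) auto
        qed
      qed
      then have "shatters F (insert x I) (u(x := p)) (v(x := q))"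
        using I(4) pq'(4) xI by (auto simp: shatters_def)
      then have "card (insert x I) < s"
        by (rule insert.prems(2)[rotated 3]) (use I(1-3) pq' in auto)
      then show "card I < t" using xI finI Suc by simp
    qed
    then have "(\<Sum>pq\<in>P. card (H pq)) \<le> card P * r ^ t"
      using sum_bounded_above[of P "\<lambda>pq. card (H pq)" "r ^ t"] by simp
    moreover have "card F \<le> card G + (\<Sum>pq\<in>P. card (H pq))"
    proof -
      \<comment> \<open>In a charged pair the first component is the chosen value \<open>w g\<close>
        and the second is \<open>f x\<close>, so \<open>f\<close> is recovered from its restriction
        \<open>g\<close> and the pair.\<close>
      have "F \<subseteq> (\<lambda>g. g(x := w g)) ` G \<union> (\<Union>pq\<in>P. (\<lambda>g. g(x := snd pq)) ` H pq)"
      proof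
        fix f assume f: "f \<in> F"
        define g where "g = f(x := undefined)"
        have fx: "f x \<in> Q" "g(x := f x) = f" using f insert.prems(1) by (auto simp: g_def)
        have gG: "g \<in> G" using f by (auto simp: G_def g_def)
        have w: "w g \<in> Q \<and> g(x := w g) \<in> F"
          unfolding w_def by (rule someI[of _ "f x"]) (use fx f in auto)
        show "f \<in> (\<lambda>g. g(x := w g)) ` G \<union> (\<Union>pq\<in>P. (\<lambda>g. g(x := snd pq)) ` H pq)"
        proof (cases "f x = w g")
          case True
          then have "f = (\<lambda>g. g(x := w g)) g" using fx(2) by simp
          then show ?thesis using gG by (intro UnI1 image_eqI)
        next
          case False
          then have "(w g, f x) \<in> P" "g \<in> H (w g, f x)"
            using w fx f gG by (auto simp: P_def H_def)
          then have "f \<in> (\<Union>pq\<in>P. (\<lambda>g. g(x := snd pq)) ` H pq)"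
            using fx(2) by (intro UN_I[of "(w g, f x)"] image_eqI[of _ _ g]) auto
          then show ?thesis by blast
        qed
      qed
      moreover have finH: "finite (H pq)" for pq
        using finG by (cases pq) (auto simp: H_def)
      ultimately have "card F \<le> card ((\<lambda>g. g(x := w g)) ` G) + card (\<Union>pq\<in>P. (\<lambda>g. g(x := snd pq)) ` H pq)"
        using finG finP by (intro order.trans[OF card_mono card_Un_le]) auto
      also have "\<dots> \<le> card G + (\<Sum>pq\<in>P. card ((\<lambda>g. g(x := snd pq)) ` H pq))"
        using finG finP by (intro add_mono card_image_le card_UN_le) auto
      also have "\<dots> \<le> card G + (\<Sum>pq\<in>P. card (H pq))"
        using finH by (intro add_mono sum_mono card_image_le) auto
      finally show ?thesis .
    qed
    ultimately have "card F \<le> r ^ s + card P * r ^ t" by linarith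
    also have "\<dots> \<le> r ^ s + C * r ^ t" using cardP by simp
    \<comment> \<open>Since \<open>s = Suc t\<close>, the two counts combine to \<open>r + C\<close>
      times \<open>r ^ t\<close>, and \<open>r + C\<close> is exactly the base belonging to
      \<open>insert x R\<close>.\<close>
    also have "\<dots> = (r + C) * r ^ t" by (simp add: Suc algebra_simps)
    also have "\<dots> \<le> (r + C) * (r + C) ^ t" by (intro mult_left_mono power_mono) auto
    also have "\<dots> = (1 + C * card (insert x R)) ^ s"
      using insert.hyps by (simp add: Suc r_def algebra_simps)
    finally show ?thesis by (simp add: C_def)
  qed
qed

section \<open>Determinants of matrices with one value on a permutation and another
  elsewhere\<close>

text \<open>The all-ones vector is an eigenvector for \<open>s\<close>; multiply by the adjugate.\<close>
lemma row_sum_dvd_det: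
  fixes M :: "'a :: comm_ring_1 mat"
  assumes M: "M \<in> carrier_mat d d" and "d > 0"
    and row_sum: "\<And>r. r < d \<Longrightarrow> (\<Sum>c<d. M $$ (r, c)) = s"
  shows "s dvd det M"
proof -
  define e :: "'a vec" where "e = vec d (\<lambda>_. 1)"
  have e: "e \<in> carrier_vec d" by (simp add: e_def)
  have "M *\<^sub>v e = s \<cdot>\<^sub>v e"
    using M row_sum by (intro eq_vecI) (auto simp: e_def scalar_prod_def lessThan_atLeast0)
  then have "(adj_mat M * M) *\<^sub>v e = adj_mat M *\<^sub>v (s \<cdot>\<^sub>v e)"
    using adj_mat(1)[OF M] M e by simp
  also have "\<dots> = s \<cdot>\<^sub>v (adj_mat M *\<^sub>v e)"
    using adj_mat(1)[OF M] e by (intro eq_vecI) auto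
  finally have "(adj_mat M * M) *\<^sub>v e = s \<cdot>\<^sub>v (adj_mat M *\<^sub>v e)" .
  moreover have "(adj_mat M * M) *\<^sub>v e = det M \<cdot>\<^sub>v e"
    unfolding adj_mat(3)[OF M] using e
    by (intro eq_vecI) auto
  ultimately have "(det M \<cdot>\<^sub>v e) $ 0 = (s \<cdot>\<^sub>v (adj_mat M *\<^sub>v e)) $ 0" by simp
  then have "det M = s * (adj_mat M *\<^sub>v e) $ 0"
    using \<open>d > 0\<close> adj_mat(1)[OF M] by (simp add: e_def)
  then show ?thesis by simp
qed

text \<open>
  The permutation \<open>\<sigma>\<close> is needed because \<^const>\<open>submatrix\<close> lists the columns in increasing order.
\<close>
lemma abs_det_ge_two_valued:
  fixes M :: "int mat"
  assumes M: "M \<in> carrier_mat d d" and "d > 0" and "a \<noteq> b"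
    and \<sigma>: "bij_betw \<sigma> {..<d} {..<d}"
    and entry: "\<And>r c. r < d \<Longrightarrow> c < d \<Longrightarrow> M $$ (r, c) = (if c = \<sigma> r then b else a)"
    and nz: "b + (int d - 1) * a \<noteq> 0"
  shows "\<bar>b + (int d - 1) * a\<bar> \<le> \<bar>det M\<bar>"
proof -
  have \<sigma>_less: "\<sigma> r < d" if "r < d" for r using \<sigma> that by (auto simp: bij_betw_def)
  \<comment> \<open>\<open>M\<close> is \<open>b - a\<close> times a permutation matrix plus
    \<open>a\<close> times the all-ones matrix. The constant \<open>f = 1\<close> yields the row
    sum; the coordinates of a vector yield its image under \<open>M\<close>.\<close>
  have row: "(\<Sum>c<d. M $$ (r, c) * f c) = (b - a) * f (\<sigma> r) + a * sum f {..<d}"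
    if r: "r < d" for r f
  proof -
    have "(\<Sum>c<d. M $$ (r, c) * f c) = (\<Sum>c<d. (if c = \<sigma> r then (b - a) * f c else 0) + a * f c)"
      using entry r by (intro sum.cong) (auto simp: algebra_simps)
    also have "\<dots> = (b - a) * f (\<sigma> r) + a * sum f {..<d}"
      using \<sigma>_less[OF r] by (simp add: sum.distrib sum_distrib_left)
    finally show ?thesis .
  qed
  have "b + (int d - 1) * a dvd det M"
    using row[of _ "\<lambda>_. 1"] by (intro row_sum_dvd_det[OF M \<open>d > 0\<close>]) (simp add: algebra_simps)
  \<comment> \<open>A kernel vector \<open>v\<close> with coordinate sum \<open>t\<close> has
    \<open>(b - a) * v $ c = - a * t\<close> for every \<open>c\<close>. Summing over
    \<open>c\<close> shows that the row sum times \<open>t\<close> is 0, so \<open>t = 0\<close> and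
    then \<open>v\<close> vanishes.\<close>
  moreover have "det M \<noteq> 0"
  proof
    assume "det M = 0"
    then obtain v where v: "v \<in> carrier_vec d" "v \<noteq> 0\<^sub>v d" "M *\<^sub>v v = 0\<^sub>v d"
      using det_0_iff_vec_prod_zero[OF M] by blast
    define t where "t = (\<Sum>c<d. v $ c)"
    have v\<sigma>: "(b - a) * v $ \<sigma> r = - a * t" if r: "r < d" for r
    proof -
      have "(M *\<^sub>v v) $ r = (\<Sum>c<d. M $$ (r, c) * v $ c)"
        using M v(1) r by (simp add: scalar_prod_def lessThan_atLeast0)
      then have "(\<Sum>c<d. M $$ (r, c) * v $ c) = 0" using v(3) r by simp
      then show ?thesis using row[OF r, of "\<lambda>c. v $ c"] by (simp add: t_def)
    qed
    have vc: "(b - a) * v $ c = - a * t" if "c < d" for c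
    proof -
      have "c \<in> \<sigma> ` {..<d}" using bij_betw_imp_surj_on[OF \<sigma>] that by simp
      then obtain r where "r < d" "c = \<sigma> r" by blast
      then show ?thesis using v\<sigma> by simp
    qed
    have "(b - a) * t = (\<Sum>c<d. (b - a) * v $ c)" by (simp add: t_def sum_distrib_left)
    also have "\<dots> = int d * (- a * t)" using vc by simp
    finally have "(b + (int d - 1) * a) * t = 0" by (simp add: algebra_simps)
    then have "t = 0" using nz by simp
    then have "v $ c = 0" if "c < d" for c using vc[OF that] \<open>a \<noteq> b\<close> by simp
    then have "v = 0\<^sub>v d" using v(1) by auto
    then show False using v(2) by simp
  qed
  ultimately show ?thesis by (intro dvd_imp_le_int)
qed

section \<open>Two-valued submatrices of k-modular matrices\<close>

lemma bij_betw_pick: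
  assumes "finite S"
  shows "bij_betw (pick S) {..<card S} S"
proof -
  have inj: "inj_on (pick S) {..<card S}"
    by (intro linorder_inj_onI') (metis lessThan_iff less_irrefl pick_mono_le)
  moreover have "pick S ` {..<card S} = S"
    using pick_in_set_le card_image[OF inj] assms by (intro card_subset_eq) auto
  ultimately show ?thesis by (simp add: bij_betw_def)
qed

text \<open>The left-hand side is the absolute row sum of the square submatrix on the rows
  \<open>I\<close> and the columns chosen by \<open>j\<close>, which are distinct because
  \<open>a \<noteq> b\<close>. Unless it is 0, this is at most the absolute value of a
  minor.\<close>

lemma k_modular_two_valued:
  assumes mod: "k_modular k A" and "finite I" "I \<noteq> {}" "a \<noteq> b"
    and I: "\<And>i. i \<in> I \<Longrightarrow> i < dim_row A" and j: "\<And>i. i \<in> I \<Longrightarrow> j i < dim_col A"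
    and entry: "\<And>i i'. i \<in> I \<Longrightarrow> i' \<in> I \<Longrightarrow> A $$ (i, j i') = (if i = i' then b else a)"
  shows "\<bar>b + (int (card I) - 1) * a\<bar> \<le> int k"
proof (cases "b + (int (card I) - 1) * a = 0")
  case False
  define J where "J = j ` I"
  define d where "d = card I"
  define M where "M = submatrix A I J"
  have inj: "inj_on j I"
    using entry \<open>a \<noteq> b\<close> by (intro inj_onI) metis
  have J: "finite J" "card J = d" using \<open>finite I\<close> card_image[OF inj] by (auto simp: J_def d_def)
  have I': "{i. i < dim_row A \<and> i \<in> I} = I" and J': "{i. i < dim_col A \<and> i \<in> J} = J"
    using I j by (auto simp: J_def)
  have M: "M \<in> carrier_mat d d"
    using I' J' J by (intro carrier_matI) (simp_all add: M_def dim_submatrix d_def)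
  have pI: "bij_betw (pick I) {..<d} I" and pJ: "bij_betw (pick J) {..<d} J"
    using bij_betw_pick[OF \<open>finite I\<close>] bij_betw_pick[OF J(1)] J(2) by (simp_all add: d_def)
  \<comment> \<open>\<open>\<sigma>\<close> sends the position of a row in the sorted
    \<open>I\<close> to the position of its column under \<open>j\<close> in the sorted
    \<open>J\<close>.\<close>
  define \<sigma> where "\<sigma> = inv_into {..<d} (pick J) \<circ> (j \<circ> pick I)"
  have "bij_betw j I J" using inj by (simp add: J_def bij_betw_def)
  then have \<sigma>: "bij_betw \<sigma> {..<d} {..<d}"
    unfolding \<sigma>_def using pI bij_betw_inv_into[OF pJ] by (metis bij_betw_trans)
  have "M $$ (r, c) = (if c = \<sigma> r then b else a)" if rc: "r < d" "c < d" for r c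
  proof -
    have "pick I r \<in> I" "pick J c \<in> J" using pI pJ rc by (auto simp: bij_betw_def)
    then obtain i where i: "i \<in> I" "pick J c = j i" by (auto simp: J_def)
    have "pick J (\<sigma> r) = j (pick I r)"
      using pJ \<open>pick I r \<in> I\<close> by (auto simp: \<sigma>_def J_def bij_betw_def f_inv_into_f)
    moreover have "\<sigma> r < d" using \<sigma> rc by (auto simp: bij_betw_def)
    ultimately have "c = \<sigma> r \<longleftrightarrow> pick I r = i"
      using i rc pJ inj \<open>pick I r \<in> I\<close>
      by (metis bij_betw_def inj_on_eq_iff lessThan_iff)
    moreover have "M $$ (r, c) = A $$ (pick I r, pick J c)"
      unfolding M_def by (rule submatrix_index) (use rc I' J' J in \<open>simp_all add: d_def\<close>)
    ultimately show ?thesis using entry[OF \<open>pick I r \<in> I\<close> i(1)] i(2) by simp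
  qed
  moreover have "d > 0" using assms(2,3) by (auto simp: d_def card_gt_0_iff)
  ultimately have "\<bar>b + (int d - 1) * a\<bar> \<le> \<bar>det M\<bar>"
    using False M \<sigma> \<open>a \<noteq> b\<close> by (intro abs_det_ge_two_valued) (auto simp: d_def)
  moreover have "\<bar>det M\<bar> \<le> int k"
  proof -
    have "I \<subseteq> {..<dim_row A}" "J \<subseteq> {..<dim_col A}" "card I = card J"
      using I j J by (auto simp: J_def d_def)
    then show ?thesis using mod unfolding M_def k_modular_def by blast
  qed
  ultimately show ?thesis by (simp add: d_def)
qed simp

section \<open>Shattered row sets and the number of distinct columns\<close>

lemma k_modular_entry:
  assumes "k_modular k A" "i < dim_row A" "j < dim_col A"
  shows "\<bar>A $$ (i, j)\<bar> \<le> int k"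
proof -
  \<comment> \<open>For a single row the off-diagonal value has coefficient 0; the entry plus 1
    serves merely as a value different from the entry.\<close>
  have "\<bar>A $$ (i, j) + (int (card {i}) - 1) * (A $$ (i, j) + 1)\<bar> \<le> int k"
    by (rule k_modular_two_valued[OF assms(1), where j = "\<lambda>_. j"]) (use assms(2,3) in simp_all)
  then show ?thesis by simp
qed

text \<open>A two-valued submatrix with \<open>a \<noteq> 0\<close> off the diagonal has row sum at
  most \<open>k\<close> in absolute value, and so is \<open>b\<close>. Hence
  \<open>card I - 1\<close> times the absolute value of \<open>a\<close>, which is at least 1, is at
  most \<open>2 * k\<close>.\<close>

lemma k_modular_card_shattered:
  assumes mod: "k_modular k A" and "finite I"
    and I: "I \<subseteq> {..<dim_row A}" and J: "J \<subseteq> {..<dim_col A}"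
    and shat: "shatters ((\<lambda>j. \<lambda>i\<in>{..<dim_row A}. A $$ (i, j)) ` J) I (\<lambda>_. p) (\<lambda>_. q)"
    and "\<bar>p\<bar> \<le> int k" "\<bar>q\<bar> \<le> int k"
  shows "card I \<le> 2 * k + 1"
proof (cases "I = {}")
  case False
  have "p \<noteq> q" using shat False by (auto simp: shatters_def)
  have ex: "\<exists>j\<in>J. \<forall>i\<in>I. A $$ (i, j) = (if i \<in> S then q else p)" if S: "S \<subseteq> I" for S
  proof -
    obtain f where f: "f \<in> (\<lambda>j. \<lambda>i\<in>{..<dim_row A}. A $$ (i, j)) ` J"
      "\<And>i. i \<in> I \<Longrightarrow> f i = (if i \<in> S then q else p)"
      using shattersE[OF shat S] by blast
    then obtain j where j: "j \<in> J" "f = (\<lambda>i\<in>{..<dim_row A}. A $$ (i, j))" by blast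
    have "A $$ (i, j) = (if i \<in> S then q else p)" if "i \<in> I" for i
      using f(2)[OF that] j(2) I that by auto
    then show ?thesis using j(1) by blast
  qed
  \<comment> \<open>The off-diagonal value must be nonzero for the row sum to grow with
    \<open>card I\<close>. If \<open>p\<close> is nonzero, the singletons \<open>{i'}\<close> put
    \<open>p\<close> off the diagonal; if \<open>p = 0\<close>, their complements in
    \<open>I\<close> put \<open>q\<close> there.\<close>
  obtain a b where ab: "a \<noteq> 0" "a \<noteq> b" "\<bar>b\<bar> \<le> int k"
    and ex': "\<forall>i'\<in>I. \<exists>j\<in>J. \<forall>i\<in>I. A $$ (i, j) = (if i = i' then b else a)"
  proof (cases "p = 0")
    case True
    have "\<exists>j\<in>J. \<forall>i\<in>I. A $$ (i, j) = (if i = i' then p else q)" if "i' \<in> I" for i'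
    proof -
      obtain j where "j \<in> J" "\<forall>i\<in>I. A $$ (i, j) = (if i \<in> I - {i'} then q else p)"
        using ex[of "I - {i'}"] by blast
      then show ?thesis by (intro bexI[of _ j]) auto
    qed
    then show ?thesis using that[of q p] True assms(6) \<open>p \<noteq> q\<close> by auto
  next
    case False
    have "\<exists>j\<in>J. \<forall>i\<in>I. A $$ (i, j) = (if i = i' then q else p)" if "i' \<in> I" for i'
      using ex[of "{i'}"] that by auto
    then show ?thesis using that[of p q] False assms(7) \<open>p \<noteq> q\<close> by auto
  qed
  obtain j where j: "\<And>i'. i' \<in> I \<Longrightarrow> j i' \<in> J"
    "\<And>i i'. i' \<in> I \<Longrightarrow> i \<in> I \<Longrightarrow> A $$ (i, j i') = (if i = i' then b else a)"
    using bchoice[OF ex'[unfolded Bex_def]] by blast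
  have "\<bar>b + (int (card I) - 1) * a\<bar> \<le> int k"
    using I J j False \<open>finite I\<close> ab by (intro k_modular_two_valued[OF mod, where j = j]) auto
  then have "\<bar>(int (card I) - 1) * a\<bar> \<le> 2 * int k" using ab(3) by linarith
  moreover have "card I \<ge> 1" using False \<open>finite I\<close> by (simp add: Suc_le_eq card_gt_0_iff)
  then have "int (card I) - 1 \<le> \<bar>(int (card I) - 1) * a\<bar>"
    using ab(1) mult_left_mono[of 1 "\<bar>a\<bar>" "int (card I) - 1"] by (simp add: abs_mult)
  ultimately show ?thesis by linarith
qed simp

text \<open>The base comes from the \<open>2 * k + 1\<close> possible entries. For the exponent, a
  shattered set splits into \<open>(2 * k + 1) ^ 2\<close> classes by the pair of values, each with
  at most \<open>2 * k + 1\<close> rows; the final 1 makes the size bound strict.\<close>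

lemma k_modular_card_distinct_cols:
  assumes mod: "k_modular k A" and J: "J \<subseteq> {..<dim_col A}" and inj: "inj_on (col A) J"
  shows "card J \<le> (1 + (2 * k + 1) ^ 2 * dim_row A) ^ ((2 * k + 1) ^ 3 + 1)"
proof -
  define m where "m = dim_row A"
  define Q where "Q = {- int k..int k}"
  define F where "F = (\<lambda>j. \<lambda>i\<in>{..<m}. A $$ (i, j)) ` J"
  have cardQ: "card Q = 2 * k + 1" by (simp add: Q_def)
  have entry: "A $$ (i, j) \<in> Q" if "i < m" "j \<in> J" for i j
    using k_modular_entry[OF mod, of i j] that J by (auto simp: Q_def m_def)
  have "inj_on (\<lambda>j. \<lambda>i\<in>{..<m}. A $$ (i, j)) J"
  proof (rule inj_onI)
    fix j j' assume jj': "j \<in> J" "j' \<in> J"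
      "(\<lambda>i\<in>{..<m}. A $$ (i, j)) = (\<lambda>i\<in>{..<m}. A $$ (i, j'))"
    then have "A $$ (i, j) = A $$ (i, j')" if "i < m" for i
      using that by (metis lessThan_iff restrict_apply')
    then have "col A j = col A j'" using jj' J by (intro eq_vecI) (auto simp: m_def subset_iff)
    then show "j = j'" using inj jj' by (simp add: inj_on_eq_iff)
  qed
  then have "card J = card F" by (simp add: F_def card_image)
  also have "\<dots> \<le> (1 + card Q ^ 2 * card {..<m}) ^ ((2 * k + 1) ^ 3 + 1)"
  proof (rule card_le_if_not_shatters)
    show "F \<subseteq> {..<m} \<rightarrow>\<^sub>E Q" 
      unfolding F_def by (intro image_subsetI) (simp add: restrict_PiE_iff entry)
    fix I u v assume I: "I \<subseteq> {..<m}" "u \<in> I \<rightarrow> Q" "v \<in> I \<rightarrow> Q" "shatters F I u v"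
    have finI: "finite I" using I(1) finite_subset by blast
    \<comment> \<open>On a fibre both value functions are constant, and every subset of it is a
      subset of \<open>I\<close>, so each fibre is shattered with a constant pair.\<close>
    define fib where "fib pq = {i \<in> I. (u i, v i) = pq}" for pq
    have "card (fib pq) \<le> 2 * k + 1" if pq: "pq \<in> Q \<times> Q" for pq
    proof -
      obtain p q where pq': "pq = (p, q)" "p \<in> Q" "q \<in> Q" using pq by auto
      have "\<exists>f\<in>F. \<forall>i\<in>fib pq. f i = (if i \<in> S then q else p)" if "S \<subseteq> fib pq" for S
      proof -
        have sub: "S \<subseteq> I" using that by (auto simp: fib_def)
        obtain f where "f \<in> F" "\<And>i. i \<in> I \<Longrightarrow> f i = (if i \<in> S then v i else u i)"
          using shattersE[OF I(4) sub] by blast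
        then show ?thesis by (intro bexI[of _ f]) (auto simp: fib_def pq')
      qed
      then have "shatters F (fib pq) (\<lambda>_. p) (\<lambda>_. q)"
        using I(4) by (auto simp: shatters_def fib_def pq')
      then show ?thesis
        using finI I(1) pq' J unfolding F_def m_def
        by (intro k_modular_card_shattered[OF mod]) (auto simp: Q_def fib_def)
    qed
    then have "(\<Sum>pq\<in>Q \<times> Q. card (fib pq)) \<le> card (Q \<times> Q) * (2 * k + 1)"
      using sum_bounded_above[of "Q \<times> Q" "\<lambda>pq. card (fib pq)" "2 * k + 1"] by simp
    also have "\<dots> = (2 * k + 1) ^ 3"
      by (simp only: card_cartesian_product cardQ power3_eq_cube)
    moreover have "I = (\<Union>pq\<in>Q \<times> Q. fib pq)" using I by (auto simp: fib_def)
    then have "card I \<le> (\<Sum>pq\<in>Q \<times> Q. card (fib pq))"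
      using card_UN_le[of "Q \<times> Q" fib] by (simp add: Q_def)
    ultimately show "card I < (2 * k + 1) ^ 3 + 1" by linarith
  qed (auto simp: Q_def)
  finally show ?thesis by (simp only: cardQ card_lessThan m_def)
qed

section \<open>Optimal solutions of small support\<close>

lemma finite_supp: "finite (supp z)"
  by (simp add: supp_def)

text \<open>Reduces the support bound to counting distinct columns: if two columns in a smallest
  optimal support were equal, one of them could be emptied at no loss.\<close>

lemma ip_optimal_distinct_cols:
  assumes "ip_optimal A b c z0" and c: "c \<in> carrier_vec (dim_col A)"
  obtains z where "ip_optimal A b c z" "inj_on (col A) (supp z)"
proof -
  obtain z where opt: "ip_optimal A b c z"
    and min: "\<And>x. ip_optimal A b c x \<Longrightarrow> card (supp z) \<le> card (supp x)"
    using ex_has_least_nat[of "ip_optimal A b c" z0 "\<lambda>x. card (supp x)"] assms(1) by blast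
  define n where "n = dim_col A"
  have feas_z: "z \<in> carrier_vec n" "A *\<^sub>v z = b" "0\<^sub>v n \<le> z"
    using opt unfolding ip_optimal_def ip_feasible_def n_def by blast+
  then have z: "z \<in> carrier_vec n" "A *\<^sub>v z = b" "\<And>i. i < n \<Longrightarrow> z $ i \<ge> 0"
    by (auto simp: less_eq_vec_def)
  have "False" if jj': "j \<in> supp z" "j' \<in> supp z" "j \<noteq> j'" "col A j = col A j'" "c $ j' \<le> c $ j" for j j'
  proof -
    have j: "j < n" "j' < n" "z $ j' \<noteq> 0" using jj' z(1) by (auto simp: supp_def)
    \<comment> \<open>All of \<open>z $ j'\<close> moves to \<open>j\<close>. Equal columns keep
      \<open>A *\<^sub>v z\<close> unchanged, the objective does not drop, \<open>j'\<close> leaves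
      the support, and nothing enters it because \<open>j\<close> already belongs to it.\<close>
    define y where "y = z + z $ j' \<cdot>\<^sub>v (unit_vec n j - unit_vec n j')"
    have y: "y \<in> carrier_vec n" using z(1) by (simp add: y_def)
    have yi: "y $ i = (if i = j then z $ j + z $ j' else if i = j' then 0 else z $ i)" if "i < n" for i
      using that z(1) j jj'(3) by (auto simp: y_def)
    have "A *\<^sub>v y = b"
    proof (rule eq_vecI)
      fix i assume "i < dim_vec b"
      then have i: "i < dim_row A" using z(2) by auto
      have "A $$ (i, j) = A $$ (i, j')"
        using jj'(4) i j by (metis index_col n_def)
      then have "row A i \<bullet> y = row A i \<bullet> z"
        using z(1) i j unfolding y_def
        by (simp add: n_def scalar_prod_add_distrib[of _ "dim_col A"] scalar_prod_minus_distrib[of _ "dim_col A"])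
      then show "(A *\<^sub>v y) $ i = b $ i" using z(2) i by auto
    qed (use z(2) in auto)
    moreover have "0\<^sub>v n \<le> y"
      using y yi z(3) j by (auto simp: less_eq_vec_def)
    ultimately have feas: "ip_feasible A b y" using y by (simp add: ip_feasible_def n_def)
    have "c \<bullet> y = c \<bullet> z + z $ j' * (c $ j - c $ j')"
      using z(1) c j unfolding y_def
      by (simp add: n_def scalar_prod_add_distrib[of _ "dim_col A"] scalar_prod_minus_distrib[of _ "dim_col A"])
    moreover have "z $ j' * (c $ j - c $ j') \<ge> 0" using z(3)[OF j(2)] jj'(5) by simp
    ultimately have "ip_optimal A b c y"
      using opt feas unfolding ip_optimal_def by (metis order_trans le_add_same_cancel1)
    then have "card (supp z) \<le> card (supp y)" by (rule min)
    moreover have "supp y \<subset> supp z"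
    proof (rule psubsetI)
      show "supp y \<subseteq> supp z"
      proof
        fix i assume "i \<in> supp y"
        then have i: "i < n" "y $ i \<noteq> 0" using y by (simp_all add: supp_def)
        then have "i = j \<or> z $ i \<noteq> 0" using yi[of i] by metis
        then show "i \<in> supp z" using jj'(1) i(1) z(1) by (auto simp: supp_def)
      qed
      have "j' \<notin> supp y" using yi[OF j(2)] jj'(3) by (simp add: supp_def)
      then show "supp y \<noteq> supp z" using jj'(2) by metis
    qed
    then have "card (supp y) < card (supp z)" by (intro psubset_card_mono finite_supp)
    ultimately show False by simp
  qed
  \<comment> \<open>The comparison of the two costs is no restriction: it holds after possibly
    exchanging \<open>j\<close> and \<open>j'\<close>.\<close>
  then have "inj_on (col A) (supp z)" by (metis inj_onI linorder_linear)
  then show ?thesis using opt that by blast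
qed

theorem corollary5:
  fixes k :: nat
  assumes "k \<ge> 1"
  shows "\<exists>p :: real poly. \<forall>(m :: nat) (n :: nat) (A :: int mat) (b :: int vec) (c :: int vec).
           m \<ge> 1 \<longrightarrow> n \<ge> 1 \<longrightarrow>
           A \<in> carrier_mat m n \<longrightarrow> b \<in> carrier_vec m \<longrightarrow> c \<in> carrier_vec n \<longrightarrow>
           k_modular k A \<longrightarrow> int_rank A = m \<longrightarrow>
           (\<exists>x. ip_feasible A b x) \<longrightarrow> (\<exists>x. ip_optimal A b c x) \<longrightarrow>
           (\<exists>z. ip_optimal A b c z \<and> real (card (supp z)) \<le> poly p (real m))"
\<comment> \<open>The witness is the column count read as a polynomial in the number of rows: a
  linear polynomial with slope \<open>(2 * k + 1) ^ 2\<close>, raised to a power that depends on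
  \<open>k\<close> alone.\<close>
proof (rule exI[of _ "[:1, real ((2 * k + 1) ^ 2):] ^ ((2 * k + 1) ^ 3 + 1)"], intro allI impI)
  fix m n :: nat and A :: "int mat" and b c :: "int vec"
  assume A: "A \<in> carrier_mat m n" "c \<in> carrier_vec n" "k_modular k A" "\<exists>x. ip_optimal A b c x"
  define s where "s = (2 * k + 1) ^ 3 + 1"
  obtain z where z: "ip_optimal A b c z" "inj_on (col A) (supp z)"
    using A ip_optimal_distinct_cols by (metis carrier_matD(2))
  have "supp z \<subseteq> {..<dim_col A}"
    using z(1) by (auto simp: ip_optimal_def ip_feasible_def supp_def)
  then have "card (supp z) \<le> (1 + (2 * k + 1) ^ 2 * m) ^ s"
    using k_modular_card_distinct_cols[OF A(3) _ z(2)] A(1) by (auto simp: s_def)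
  then have "real (card (supp z)) \<le> real ((1 + (2 * k + 1) ^ 2 * m) ^ s)"
    by (simp only: of_nat_le_iff)
  also have "\<dots> = poly ([:1, real ((2 * k + 1) ^ 2):] ^ s) (real m)"
    by (simp add: poly_power algebra_simps)
  finally show "\<exists>z. ip_optimal A b c z \<and> real (card (supp z)) \<le>
      poly ([:1, real ((2 * k + 1) ^ 2):] ^ ((2 * k + 1) ^ 3 + 1)) (real m)"
    using z(1) unfolding s_def by blast
qed

end
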